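(* Let $A\subsetneq B\subset\mathbb{N}$ and $k=\min(B\setminus A)$. If $A\prec B$, then $A\prec A\cup\{k\}$.
   Context: For $n\in\mathbb{N}$, $D(n)$ is the set of positive divisors of $n$. For $A\subset\mathbb{N}$, $S_A=\sum_{a\in A}a$ ($S_\emptyset=0$, $S_A=+\infty$ for infinite $A$), and $A$ is a practical set if every non-negative integer $k\le S_A$ is a sum of distinct elements of $A$. A number $m\in\mathbb{N}$ is $A$-practical if $D(m)\cap A$ is a practical set, and $\Pr(A)$ is the set of all $A$-practical numbers. For $A,A'\subset\mathbb{N}$, $A\prec A'$ means $A\subseteq A'$ and $\Pr(A)\subseteq\Pr(A')$. *)

theory Defs
  imports Main "HOL-Library.Extended_Nat"
begin

text \<open>Sets of positive integers are represented as sets of type \<^typ>\<open>nat set\<close>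
  that do not contain 0.\<close>

definition D :: "nat \<Rightarrow> nat set" where
  "D n = {d. d > 0 \<and> d dvd n}"

definition set_sum :: "nat set \<Rightarrow> enat" where
  "set_sum A = (if finite A then enat (\<Sum>a\<in>A. a) else \<infinity>)"

definition practical_set :: "nat set \<Rightarrow> bool" where
  "practical_set A \<longleftrightarrow>
     (\<forall>k::nat. enat k \<le> set_sum A \<longrightarrow> (\<exists>F. finite F \<and> F \<subseteq> A \<and> (\<Sum>a\<in>F. a) = k))"

definition Pr :: "nat set \<Rightarrow> nat set" where
  "Pr A = {m. m > 0 \<and> practical_set (D m \<inter> A)}"

definition prec :: "nat set \<Rightarrow> nat set \<Rightarrow> bool"  (infix \<open>\<prec>\<close> 50) where
  "A \<prec> A' \<longleftrightarrow> A \<subseteq> A' \<and> Pr A \<subseteq> Pr A'"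

end

theory Submission
  imports Defs
begin

text \<open>Let \<open>m\<close> be \<open>A\<close>-practical. If \<open>k\<close> does not divide
  \<open>m\<close>, then \<open>D m\<close> meets \<open>A\<close> and \<open>A \<union> {k}\<close>
  in the same set. If it does, \<open>m\<close> is also \<open>B\<close>-practical, so
  \<open>k - 1\<close> is a sum of distinct divisors of \<open>m\<close> in \<open>B\<close>; these
  are below \<open>k\<close>, hence in \<open>A\<close> by minimality of \<open>k\<close>. So
  \<open>k\<close> exceeds the sum of \<open>D m \<inter> A\<close> by at most 1
  (\<open>practical_set_le_sum_smaller\<close>), and adjoining such a number to a finite practical
  set leaves it practical (\<open>practical_set_insert\<close>).\<close>

lemma finite_D: "m > 0 \<Longrightarrow> finite (D m)"
  by (simp add: D_def)

lemma practical_set_finite: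
  assumes "finite A"
  shows "practical_set A \<longleftrightarrow> (\<forall>j\<le>\<Sum>A. \<exists>F\<subseteq>A. \<Sum>F = j)"
proof -
  have "finite F \<and> F \<subseteq> A \<and> \<Sum>F = j \<longleftrightarrow> F \<subseteq> A \<and> \<Sum>F = j" for F j
    using finite_subset[OF _ assms] by blast
  then show ?thesis
    using assms by (simp add: practical_set_def set_sum_def)
qed

text \<open>The old subset sums fill the interval from 0 to \<open>\<Sum>S\<close>. Adding
  \<open>k\<close> shifts it to start at \<open>k\<close>, and the bound on \<open>k\<close> ensures
  that no gap opens between the two intervals.\<close>

lemma practical_set_insert:
  assumes fin: "finite S" and prac: "practical_set S" and "k \<notin> S" and le: "k \<le> \<Sum>S + 1"
  shows "practical_set (insert k S)"
proof -
  have "\<exists>F\<subseteq>insert k S. \<Sum>F = j" if "j \<le> \<Sum>(insert k S)" for j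
  proof (cases "j \<le> \<Sum>S")
    case True
    then show ?thesis
      using prac fin by (auto simp: practical_set_finite)
  next
    case False
    have "j - k \<le> \<Sum>S"
      using that fin \<open>k \<notin> S\<close> by simp
    then obtain F where F: "F \<subseteq> S" "\<Sum>F = j - k"
      using prac fin by (auto simp: practical_set_finite)
    have "finite F" "k \<notin> F"
      using F \<open>k \<notin> S\<close> finite_subset[OF _ fin] by auto
    \<comment> \<open>The subtraction \<open>j - k\<close> is not truncated:
      \<open>j > \<Sum>S\<close> and \<open>k \<le> \<Sum>S + 1\<close> give
      \<open>k \<le> j\<close>.\<close>
    then have "\<Sum>(insert k F) = j"
      using F False le by simp
    then show ?thesis
      using F by blast
  qed
  then show ?thesis
    using fin by (simp add: practical_set_finite)
qed

text \<open>A representation of \<open>k - 1\<close> can only use elements below \<open>k\<close>.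
  The target is \<open>k - 1\<close> because \<open>k\<close> itself has the useless representation
  by \<open>{k}\<close>.\<close>

lemma practical_set_le_sum_smaller:
  assumes fin: "finite T" and prac: "practical_set T" and "k \<in> T" "k > 0"
  shows "k \<le> \<Sum>{x \<in> T. x < k} + 1"
proof -
  have "k - 1 \<le> \<Sum>T"
    using member_le_sum[of k T "\<lambda>x. x"] assms by simp
  then obtain F where F: "F \<subseteq> T" "\<Sum>F = k - 1"
    using prac fin by (auto simp: practical_set_finite)
  have "x < k" if "x \<in> F" for x
    using member_le_sum[of x F "\<lambda>x. x"] that F \<open>k > 0\<close> finite_subset[OF F(1) fin] by simp
  then have "\<Sum>F \<le> \<Sum>{x \<in> T. x < k}"
    using F fin by (intro sum_mono2) auto
  then show ?thesis
    using F by simp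
qed

theorem theorem3p18:
  fixes A B :: "nat set" and k :: nat
  assumes "0 \<notin> B"
    and "A \<subset> B"
    and "k = (LEAST x. x \<in> B - A)"
    and "A \<prec> B"
  shows "A \<prec> A \<union> {k}"
proof -
  have k: "k \<in> B - A"
    using LeastI_ex[of "\<lambda>x. x \<in> B - A"] assms(2,3) by blast
  then have "k > 0"
    using assms(1) by (auto intro: gr0I)
  have below: "x \<in> A" if "x \<in> B" "x < k" for x
    using that not_less_Least[of x "\<lambda>x. x \<in> B - A"] assms(3) by auto
  have "m \<in> Pr (A \<union> {k})" if m: "m \<in> Pr A" for m
  proof (cases "k \<in> D m")
    case True
    have "m > 0" and A: "practical_set (D m \<inter> A)" and B: "practical_set (D m \<inter> B)"
      using m assms(4) by (auto simp: Pr_def prec_def)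
    note fin = finite_D[OF \<open>m > 0\<close>]
    have "k \<le> \<Sum>{x \<in> D m \<inter> B. x < k} + 1"
      using practical_set_le_sum_smaller[OF _ B] fin True k \<open>k > 0\<close> by simp
    \<comment> \<open>Minimality of \<open>k\<close> in \<open>B - A\<close> enters here: elements
      of \<open>B\<close> below \<open>k\<close> lie in \<open>A\<close>.\<close>
    also have "\<dots> \<le> \<Sum>(D m \<inter> A) + 1"
      using fin below by (intro add_right_mono sum_mono2) auto
    finally have "practical_set (insert k (D m \<inter> A))"
      using practical_set_insert[OF _ A] fin k by simp
    moreover have "D m \<inter> (A \<union> {k}) = insert k (D m \<inter> A)"
      using True by auto
    ultimately show ?thesis
      using \<open>m > 0\<close> by (simp add: Pr_def)
  next
    case False
    then have "D m \<inter> (A \<union> {k}) = D m \<inter> A"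
      by auto
    then show ?thesis
      using m by (simp add: Pr_def)
  qed
  then show ?thesis
    by (auto simp: prec_def)
qed

end
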